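(* For every integer $k\geq 2$ there is a polynomial $h(x)$, depending only on $k$, such that the following holds. For every $\epsilon\in(0,1)$ and every prime $p$ there is $n_1=n_1(k,\epsilon,p)$ such that for each $n\geq n_1$: if $G:=\mathbb{F}_p^n$ and $A\subseteq G$ is $k$-stable, then there is a subspace $H\leq G$ of codimension at most $h(1/\epsilon)$ and a set $I\subseteq G/H$ such that $$\Bigl|A\,\Delta \bigcup_{g+H\in I}(g+H)\Bigr|\leq \epsilon|G|.$$
   Context: Let $G$ be an abelian group, $A\subseteq G$ and $k\geq 1$ an integer. The set $A$ has the $k$-order property if there exist $a_1,\ldots,a_k,b_1,\ldots,b_k\in G$ such that for all $1\leq i,j\leq k$, $a_i+b_j\in A$ if and only if $i\leq j$. The set $A$ is $k$-stable if it does not have the $k$-order property. $\Delta$ denotes symmetric difference, and $G/H$ the set of cosets of $H$. *)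

theory Defs
  imports
    "HOL-Number_Theory.Residues"
    "HOL-Computational_Algebra.Polynomial"
    "Jordan_Normal_Form.Missing_VectorSpace"
begin

text \<open>Abelian groups are written additively and taken from the additive structure of a ring or
  module record; only \<open>carrier\<close> and \<open>\<oplus>\<close> are used here.\<close>

definition order_property :: "('a, 'm) ring_scheme \<Rightarrow> nat \<Rightarrow> 'a set \<Rightarrow> bool" where
  "order_property G k A \<longleftrightarrow>
     (\<exists>a b. (\<forall>i\<in>{1..k}. a i \<in> carrier G \<and> b i \<in> carrier G) \<and>
            (\<forall>i\<in>{1..k}. \<forall>j\<in>{1..k}. a i \<oplus>\<^bsub>G\<^esub> b j \<in> A \<longleftrightarrow> i \<le> (j :: nat)))"

definition k_stable :: "('a, 'm) ring_scheme \<Rightarrow> nat \<Rightarrow> 'a set \<Rightarrow> bool" where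
  "k_stable G k A \<longleftrightarrow> \<not> order_property G k A"

abbreviation prime_field :: "nat \<Rightarrow> int ring" where
  "prime_field p \<equiv> residue_ring (int p)"

text \<open>The space of \<open>n\<close>-tuples over the field with \<open>p\<close> elements. Tuples are extensional functions,
  \<open>undefined\<close> outside \<open>{..<n}\<close>, so the carrier has exactly \<open>p ^ n\<close> elements. The
  multiplicative fields of the underlying record carry no meaning.\<close>

definition prime_field_power :: "nat \<Rightarrow> nat \<Rightarrow> (int, nat \<Rightarrow> int) module" where
  "prime_field_power p n = ring.func_space (prime_field p) {..<n}"

text \<open>Meant for a subspace \<open>H\<close> of a finite-dimensional \<open>V\<close>, where the subtraction does not truncate.\<close>

definition codim :: "('k, 'b) ring_scheme \<Rightarrow> ('k, 'v, 'c) module_scheme \<Rightarrow> 'v set \<Rightarrow> nat" where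
  "codim K V H = vectorspace.dim K V - vectorspace.dim K (V\<lparr>carrier := H\<rparr>)"

lemma vectorspace_prime_field_power:
  assumes "prime p"
  shows "vectorspace (prime_field p) (prime_field_power p n)"
proof -
  interpret residues_prime p "prime_field p"
    using assms by (simp add: residues_prime_def)
  show ?thesis
    unfolding prime_field_power_def vectorspace_def
    using func_space_is_module is_field by blast
qed

lemma card_prime_field_power:
  assumes "prime p"
  shows "card (carrier (prime_field_power p n)) = p ^ n"
proof -
  interpret residues_prime p "prime_field p"
    using assms by (simp add: residues_prime_def)
  show ?thesis
    by (simp add: prime_field_power_def func_space_def card_PiE) (simp add: residue_ring_def)
qed

end

theory Submission
  imports Defs "HOL-Library.Indicator_Function"
begin

text \<open>
  Write \<open>N = |G|\<close> and \<open>d h = |A \<Delta> (A - h)|\<close>. Stability enters only through bounded VC dimension: if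
  the translates of \<open>A\<close> shatter \<open>k\<close> points \<open>b\<^sub>1, \<dots>, b\<^sub>k\<close>, then a translate cutting out exactly
  \<open>{b\<^sub>i, \<dots>, b\<^sub>k}\<close> for each \<open>i\<close> yields the \<open>k\<close>-order property (\<open>stable_imp_not_shatters\<close>). By the
  Sauer-Shelah bound a family of subsets of \<open>G\<close> that shatters no \<open>k\<close> points and whose members
  differ pairwise on more than \<open>\<delta> N\<close> points has size polynomial in \<open>1/\<delta>\<close>
  (\<open>card_separated_family_le\<close>). Covering \<open>G\<close> by a maximal separated family of translates shows that
  the set \<open>S = {h. d h \<le> \<delta> N}\<close> of almost-periods has density at least \<open>1/M\<close>, where \<open>M\<close> is polynomial
  in \<open>1/\<delta>\<close> (\<open>many_almost_periods\<close>).

  A dense set of almost-periods forces a whole subspace of them, of codimension depending only on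
  the density and not on \<open>p\<close> (\<open>few_characters_control_periods\<close>). By Parseval,
  \<open>N d h = \<Sum>\<^sub>\<xi> w\<^sub>\<xi> |\<chi>\<^sub>\<xi> h - 1|\<^sup>2\<close> with the weights \<open>w\<^sub>\<xi> \<ge> 0\<close> given by the Fourier coefficients of \<open>A\<close>.
  Let \<open>\<Gamma>\<close> consist of those \<open>\<xi>\<close> for which the mean of \<open>\<chi>\<^sub>\<xi>\<close> over \<open>S\<close> has real part at least \<open>1/2\<close>;
  Parseval for the indicator function of \<open>S\<close> gives \<open>|\<Gamma>| \<le> 4 N / |S| \<le> 4 M\<close>. For \<open>\<xi>\<close> outside \<open>\<Gamma>\<close> the
  mean of \<open>|\<chi>\<^sub>\<xi> h - 1|\<^sup>2\<close> over \<open>h \<in> S\<close> is at least \<open>1\<close>, so averaging the formula for \<open>d\<close> over \<open>S\<close>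
  bounds the total weight outside \<open>\<Gamma>\<close> by \<open>\<delta> N\<^sup>2\<close>. On the annihilator \<open>H\<close> of \<open>\<Gamma>\<close> only this weight
  contributes, whence \<open>d h \<le> 4 \<delta> N\<close> for all \<open>h \<in> H\<close>. The characters take values in the \<open>p\<close>-th roots
  of unity, so \<open>H\<close> has codimension at most \<open>|\<Gamma>|\<close>.

  Finally, taking the union of those cosets of \<open>H\<close> at least half of which lies in \<open>A\<close> loses a factor
  \<open>2\<close> (\<open>round_to_cosets\<close>): the error is at most \<open>8 \<delta> N\<close>, and \<open>\<delta> = \<epsilon>/8\<close> works.
\<close>

section \<open>Shattering\<close>

definition shatters :: "'a set set \<Rightarrow> 'a set \<Rightarrow> bool" where
  "shatters F T \<longleftrightarrow> (\<forall>U\<subseteq>T. \<exists>S\<in>F. S \<inter> T = U)"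

text \<open>
  Pajor's form of the Sauer-Shelah lemma. Remove a point \<open>b\<close>: the traces \<open>F0\<close> of \<open>F\<close> on the remaining
  points and the family \<open>F1\<close> of traces that arise from two members of \<open>F\<close> together have as many
  members as \<open>F\<close>. A set shattered by \<open>F0\<close> is shattered by \<open>F\<close>, and a set shattered by \<open>F1\<close> remains
  shattered by \<open>F\<close> after \<open>b\<close> is added to it; these two kinds are distinguished by \<open>b\<close>.
\<close>

lemma card_le_card_shattered:
  assumes "finite B" "F \<subseteq> Pow B"
  shows "card F \<le> card {T. T \<subseteq> B \<and> shatters F T}"
  using assms
proof (induction B arbitrary: F rule: finite_induct)
  case empty
  show ?case
  proof (cases "F = {}")
    case False
    then have "F = {{}}" using empty.prems by (simp add: subset_singleton_iff)
    moreover have "{T. T \<subseteq> {} \<and> shatters {{}} T} = {{} :: 'a set}"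
      unfolding shatters_def by blast
    ultimately show ?thesis by simp
  qed simp
next
  case (insert b B)
  define F0 where "F0 = (\<lambda>S. S - {b}) ` F"
  define F1 where "F1 = {S \<in> F. b \<notin> S \<and> insert b S \<in> F}"
  define Sh where "Sh = {T. T \<subseteq> insert b B \<and> shatters F T}"
  have sub: "F0 \<subseteq> Pow B" "F1 \<subseteq> Pow B"
    using insert.prems unfolding F0_def F1_def by blast+
  have fin: "finite F" "finite F0" "finite F1"
    using finite_subset[OF insert.prems] finite_subset[OF sub(1)] finite_subset[OF sub(2)] insert.hyps(1)
    by auto
  have finSh: "finite Sh" using insert.hyps(1) by (simp add: Sh_def)
  have F_split: "F = {S\<in>F. b \<notin> S} \<union> {S\<in>F. b \<in> S}" by auto
  have cF: "card F = card {S\<in>F. b \<notin> S} + card {S\<in>F. b \<in> S}"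
    by (subst F_split, rule card_Un_disjoint) (use fin in auto)
  have inj: "inj_on (\<lambda>S. S - {b}) {S\<in>F. b \<in> S}"
    by (rule inj_onI) blast
  have F0_split: "F0 = {S\<in>F. b \<notin> S} \<union> (\<lambda>S. S - {b}) ` {S\<in>F. b \<in> S}"
  proof -
    have "(\<lambda>S. S - {b}) ` {S\<in>F. b \<notin> S} = {S\<in>F. b \<notin> S}"
      using image_cong[of "{S\<in>F. b \<notin> S}" _ "\<lambda>S. S - {b}" "\<lambda>S. S"] by simp
    moreover have "F0 = (\<lambda>S. S - {b}) ` {S\<in>F. b \<notin> S} \<union> (\<lambda>S. S - {b}) ` {S\<in>F. b \<in> S}"
      unfolding F0_def image_Un[symmetric] F_split[symmetric] by (rule refl)
    ultimately show ?thesis by simp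
  qed
  have F1_Int: "{S\<in>F. b \<notin> S} \<inter> (\<lambda>S. S - {b}) ` {S\<in>F. b \<in> S} = F1"
  proof (intro subset_antisym subsetI)
    fix S assume "S \<in> {S\<in>F. b \<notin> S} \<inter> (\<lambda>S. S - {b}) ` {S\<in>F. b \<in> S}"
    then obtain S' where "S \<in> F" "b \<notin> S" "S' \<in> F" "b \<in> S'" "S = S' - {b}" by blast
    then show "S \<in> F1" by (simp add: F1_def insert_absorb)
  next
    fix S assume "S \<in> F1"
    then have S: "S \<in> F" "b \<notin> S" "insert b S \<in> F" by (simp_all add: F1_def)
    then have "S = insert b S - {b}" by simp
    with S show "S \<in> {S\<in>F. b \<notin> S} \<inter> (\<lambda>S. S - {b}) ` {S\<in>F. b \<in> S}" by blast
  qed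
  have "card F = card F0 + card F1"
    using card_Un_Int[of "{S\<in>F. b \<notin> S}" "(\<lambda>S. S - {b}) ` {S\<in>F. b \<in> S}"] fin
    by (simp add: cF F0_split[symmetric] F1_Int card_image[OF inj])
  also have "\<dots> \<le> card {T. T \<subseteq> B \<and> shatters F0 T} + card {T. T \<subseteq> B \<and> shatters F1 T}"
    using insert.IH[OF sub(1)] insert.IH[OF sub(2)] by simp
  also have "card {T. T \<subseteq> B \<and> shatters F1 T} = card (insert b ` {T. T \<subseteq> B \<and> shatters F1 T})"
  proof (rule card_image[symmetric], rule inj_onI)
    fix T T' assume "T \<in> {T. T \<subseteq> B \<and> shatters F1 T}" "T' \<in> {T. T \<subseteq> B \<and> shatters F1 T}"
    then have "b \<notin> T" "b \<notin> T'" using insert.hyps(2) by blast+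
    then show "insert b T = insert b T' \<Longrightarrow> T = T'" by (simp add: insert_ident)
  qed
  also have "card {T. T \<subseteq> B \<and> shatters F0 T} + card (insert b ` {T. T \<subseteq> B \<and> shatters F1 T})
      = card ({T. T \<subseteq> B \<and> shatters F0 T} \<union> insert b ` {T. T \<subseteq> B \<and> shatters F1 T})"
  proof (rule card_Un_disjoint[symmetric])
    show "{T. T \<subseteq> B \<and> shatters F0 T} \<inter> insert b ` {T. T \<subseteq> B \<and> shatters F1 T} = {}"
      using insert.hyps(2) by blast
  qed (use insert.hyps(1) in simp_all)
  also have "\<dots> \<le> card Sh"
  proof (rule card_mono[OF finSh], rule Un_least)
    show "{T. T \<subseteq> B \<and> shatters F0 T} \<subseteq> Sh"
    proof clarify
      fix T assume T: "T \<subseteq> B" "shatters F0 T"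
      have "\<exists>S\<in>F. S \<inter> T = U" if "U \<subseteq> T" for U
      proof -
        obtain S where "S \<in> F" "(S - {b}) \<inter> T = U"
          using T(2) \<open>U \<subseteq> T\<close> unfolding shatters_def F0_def by blast
        moreover have "(S - {b}) \<inter> T = S \<inter> T"
          using T(1) insert.hyps(2) by blast
        ultimately show ?thesis by auto
      qed
      then show "T \<in> Sh" using T(1) unfolding Sh_def shatters_def by blast
    qed
    show "insert b ` {T. T \<subseteq> B \<and> shatters F1 T} \<subseteq> Sh"
    proof clarify
      fix T assume T: "T \<subseteq> B" "shatters F1 T"
      have "\<exists>S\<in>F. S \<inter> insert b T = U" if "U \<subseteq> insert b T" for U
      proof -
        have "U - {b} \<subseteq> T" using \<open>U \<subseteq> insert b T\<close> by blast
        then obtain S where S: "S \<in> F1" "S \<inter> T = U - {b}"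
          using T(2) unfolding shatters_def by blast
        show ?thesis
        proof (cases "b \<in> U")
          case True
          then have "insert b S \<inter> insert b T = U" using S(2) by blast
          then show ?thesis using S(1) unfolding F1_def by blast
        next
          case False
          moreover have "b \<notin> S" using S(1) by (simp add: F1_def)
          ultimately have "S \<inter> insert b T = U" using S(2) by blast
          then show ?thesis using S(1) unfolding F1_def by blast
        qed
      qed
      then show "insert b T \<in> Sh" using T(1) unfolding Sh_def shatters_def by blast
    qed
  qed
  finally show ?case by (simp add: Sh_def)
qed

lemma shatters_mono:
  assumes "shatters F T" "T' \<subseteq> T"
  shows "shatters F T'"
  unfolding shatters_def
proof (intro allI impI)
  fix U assume "U \<subseteq> T'"
  then obtain S where "S \<in> F" "S \<inter> T = U"
    using assms unfolding shatters_def by (meson order_trans)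
  then show "\<exists>S\<in>F. S \<inter> T' = U"
    using \<open>U \<subseteq> T'\<close> assms(2) by blast
qed

lemma card_small_subsets_le:
  assumes "finite B"
  shows "card {T. T \<subseteq> B \<and> card T < k} \<le> (card B + 1) ^ k"
proof -
  have "{T. T \<subseteq> B \<and> card T < k} = (\<Union>i<k. {T. T \<subseteq> B \<and> card T = i})" by auto
  then have "card {T. T \<subseteq> B \<and> card T < k} \<le> (\<Sum>i<k. card {T. T \<subseteq> B \<and> card T = i})"
    using card_UN_le[of "{..<k}" "\<lambda>i. {T. T \<subseteq> B \<and> card T = i}"] by simp
  also have "\<dots> = (\<Sum>i<k. card B choose i)"
    by (simp add: n_subsets[OF assms])
  also have "\<dots> \<le> (\<Sum>i<k. (k choose i) * card B ^ i)"
  proof (rule sum_mono)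
    fix i assume "i \<in> {..<k}"
    then have "1 \<le> k choose i" by (simp add: Suc_leI)
    moreover have "card B choose i \<le> card B ^ i"
    proof (cases "i \<le> card B")
      case True then show ?thesis by (rule binomial_le_pow)
    qed (simp add: binomial_eq_0)
    ultimately show "card B choose i \<le> (k choose i) * card B ^ i"
      using mult_le_mono by fastforce
  qed
  also have "\<dots> \<le> (\<Sum>i\<le>k. (k choose i) * card B ^ i)"
    by (rule sum_mono2) auto
  also have "\<dots> = (card B + 1) ^ k"
    using binomial[of "card B" 1 k] by simp
  finally show ?thesis .
qed

lemma sauer_shelah:
  assumes "finite B" "F \<subseteq> Pow B"
    and no_shatter: "\<And>T. T \<subseteq> B \<Longrightarrow> card T = k \<Longrightarrow> \<not> shatters F T"
  shows "card F \<le> (card B + 1) ^ k"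
proof -
  have "card T < k" if T: "T \<subseteq> B" "shatters F T" for T
  proof (rule ccontr)
    assume "\<not> card T < k"
    then obtain T' where "T' \<subseteq> T" "card T' = k"
      by (meson not_less obtain_subset_with_card_n)
    then show False using no_shatter[of T'] shatters_mono[OF T(2)] T(1) by blast
  qed
  then have "{T. T \<subseteq> B \<and> shatters F T} \<subseteq> {T. T \<subseteq> B \<and> card T < k}" by blast
  then have "card {T. T \<subseteq> B \<and> shatters F T} \<le> card {T. T \<subseteq> B \<and> card T < k}"
    by (rule card_mono[rotated]) (simp add: assms(1))
  then show ?thesis
    using card_le_card_shattered[OF assms(1,2)] card_small_subsets_le[OF assms(1), of k] by linarith
qed

section \<open>Families of well separated sets\<close>

text \<open>
  A greedy version of random sampling. A point of \<open>E\<close> chosen at random distinguishes each pair with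
  probability at least \<open>\<delta>\<close>, so some point leaves at most the proportion \<open>1 - \<delta>\<close> of the pairs that
  are not yet distinguished.
\<close>

lemma exists_separating_sample:
  fixes f :: "'x \<Rightarrow> 'a set" and \<delta> :: real
  assumes "finite X" "finite E" "E \<noteq> {}" "\<delta> \<le> 1"
    and sep: "\<And>x y. x \<in> X \<Longrightarrow> y \<in> X \<Longrightarrow> x \<noteq> y \<Longrightarrow>
      \<delta> * card E \<le> card {b\<in>E. (b \<in> f x) \<noteq> (b \<in> f y)}"
  shows "\<exists>B\<subseteq>E. card B \<le> m \<and>
    card {(x, y). x \<in> X \<and> y \<in> X \<and> x \<noteq> y \<and> f x \<inter> B = f y \<inter> B} \<le> (1 - \<delta>) ^ m * (card X)\<^sup>2"
proof (induction m)
  case 0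
  have "card {(x, y). x \<in> X \<and> y \<in> X \<and> x \<noteq> y \<and> f x \<inter> {} = f y \<inter> {}} \<le> card (X \<times> X)"
    by (rule card_mono) (use \<open>finite X\<close> in auto)
  also have "\<dots> = (card X)\<^sup>2" by (simp add: card_cartesian_product power2_eq_square)
  finally have "real (card {(x, y). x \<in> X \<and> y \<in> X \<and> x \<noteq> y \<and> f x \<inter> {} = f y \<inter> {}}) \<le> real ((card X)\<^sup>2)"
    by (rule of_nat_mono)
  then show ?case
    by (intro exI[of _ "{}"]) simp
next
  case (Suc m)
  then obtain B where B: "B \<subseteq> E" "card B \<le> m"
    and le: "card {(x, y). x \<in> X \<and> y \<in> X \<and> x \<noteq> y \<and> f x \<inter> B = f y \<inter> B} \<le> (1 - \<delta>) ^ m * (card X)\<^sup>2"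
    by blast
  define P where "P = {(x, y). x \<in> X \<and> y \<in> X \<and> x \<noteq> y \<and> f x \<inter> B = f y \<inter> B}"
  define Q where "Q b = {(x, y). (x, y) \<in> P \<and> ((b \<in> f x) \<longleftrightarrow> (b \<in> f y))}" for b
  have "P \<subseteq> X \<times> X" unfolding P_def by blast
  then have finP: "finite P"
    by (rule finite_subset) (use \<open>finite X\<close> in simp)
  have "(\<Sum>b\<in>E. card (Q b)) = (\<Sum>b\<in>E. \<Sum>q\<in>P. if (b \<in> f (fst q)) \<longleftrightarrow> (b \<in> f (snd q)) then 1 else 0)"
    unfolding Q_def by (intro sum.cong refl) (auto simp: sum.If_cases[OF finP] intro!: arg_cong[where f = card])
  also have "\<dots> = (\<Sum>q\<in>P. card {b\<in>E. (b \<in> f (fst q)) \<longleftrightarrow> (b \<in> f (snd q))})"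
    by (subst sum.swap) (simp add: sum.If_cases[OF \<open>finite E\<close>] Int_def)
  finally have "real (\<Sum>b\<in>E. card (Q b)) = (\<Sum>q\<in>P. real (card {b\<in>E. (b \<in> f (fst q)) \<longleftrightarrow> (b \<in> f (snd q))}))"
    by simp
  also have "\<dots> \<le> (\<Sum>q\<in>P. (1 - \<delta>) * card E)"
  proof (rule sum_mono)
    fix q assume "q \<in> P"
    then obtain x y where q: "q = (x, y)" "x \<in> X" "y \<in> X" "x \<noteq> y" unfolding P_def by blast
    have "card E = card {b\<in>E. (b \<in> f x) \<noteq> (b \<in> f y)} + card {b\<in>E. (b \<in> f x) \<longleftrightarrow> (b \<in> f y)}"
      by (subst card_Un_disjoint[symmetric])
        (use \<open>finite E\<close> in \<open>auto intro!: arg_cong[where f = card]\<close>)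
    then show "real (card {b\<in>E. (b \<in> f (fst q)) \<longleftrightarrow> (b \<in> f (snd q))}) \<le> (1 - \<delta>) * card E"
      using sep[OF q(2-4)] by (simp add: q(1) algebra_simps)
  qed
  finally have sum_le: "(\<Sum>b\<in>E. real (card (Q b))) \<le> card E * ((1 - \<delta>) * card P)" by (simp add: mult_ac)
  have "\<exists>b\<in>E. card (Q b) \<le> (1 - \<delta>) * card P"
  proof (rule ccontr)
    assume "\<not> ?thesis"
    then have "(\<Sum>b\<in>E. (1 - \<delta>) * card P) < (\<Sum>b\<in>E. real (card (Q b)))"
      using assms(2,3) by (intro sum_strict_mono) auto
    then show False using sum_le by simp
  qed
  then obtain b where b: "b \<in> E" "card (Q b) \<le> (1 - \<delta>) * card P" by blast
  have "(1 - \<delta>) * card P \<le> (1 - \<delta>) * ((1 - \<delta>) ^ m * (card X)\<^sup>2)"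
    using le assms(4) unfolding P_def by (intro mult_left_mono) auto
  with b(2) have "card (Q b) \<le> (1 - \<delta>) ^ Suc m * (card X)\<^sup>2" by simp
  moreover have "Q b = {(x, y). x \<in> X \<and> y \<in> X \<and> x \<noteq> y \<and> f x \<inter> insert b B = f y \<inter> insert b B}"
    unfolding Q_def P_def by blast
  moreover have "card (insert b B) \<le> Suc m"
    using B(2) finite_subset[OF B(1) assms(2)] by (simp add: card_insert_if)
  ultimately show ?case
    using b(1) B(1) by (intro exI[of _ "insert b B"]) auto
qed

text \<open>
  Removes the logarithm from the estimate that sampling produces: \<open>ln M\<close> is at most \<open>2 k\<close> times the
  \<open>2 k\<close>-th root of \<open>M\<close>, so the \<open>k\<close>-th power on the right costs only a square root of \<open>M\<close>.
\<close>

lemma le_of_le_log_power: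
  fixes M \<delta> :: real
  assumes "1 \<le> M" "0 < \<delta>" "\<delta> \<le> 1" "0 < k"
    and le: "M \<le> (2 * ln M / \<delta> + 2) ^ k"
  shows "M \<le> ((4 * real k + 2) / \<delta>) ^ (2 * k)"
proof -
  define u where "u = root (2 * k) M"
  have u: "u ^ (2 * k) = M" "1 \<le> u"
    using assms by (simp_all add: u_def)
  have "ln M = 2 * k * ln u"
    unfolding u(1)[symmetric] using u(2) by (simp add: ln_realpow)
  also have "\<dots> \<le> 2 * k * u"
    using ln_le_minus_one[of u] u(2) by (intro mult_left_mono) auto
  finally have "2 * ln M \<le> 4 * real k * u" by (simp add: mult.commute)
  then have "2 * ln M / \<delta> \<le> 4 * real k * u / \<delta>"
    using assms(2) by (intro divide_right_mono) auto
  moreover have "2 \<le> 2 * u / \<delta>"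
    using u(2) assms(2,3) by (simp add: le_divide_eq)
  ultimately have "2 * ln M / \<delta> + 2 \<le> (4 * real k + 2) / \<delta> * u"
    by (simp add: add_divide_distrib algebra_simps)
  moreover have "0 \<le> 2 * ln M / \<delta> + 2"
    using assms by (simp add: add_nonneg_nonneg)
  ultimately have "(2 * ln M / \<delta> + 2) ^ k \<le> ((4 * real k + 2) / \<delta> * u) ^ k"
    by (rule power_mono)
  with le have "M \<le> ((4 * real k + 2) / \<delta> * u) ^ k" by (rule order_trans)
  moreover have M_eq: "M = u ^ k * u ^ k"
    by (simp only: u(1)[symmetric] mult_2 power_add)
  ultimately have "u ^ k * u ^ k \<le> ((4 * real k + 2) / \<delta>) ^ k * u ^ k"
    by (simp only: power_mult_distrib)
  then have "u ^ k \<le> ((4 * real k + 2) / \<delta>) ^ k"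
    using u(2) by simp
  then have "u ^ k * u ^ k \<le> ((4 * real k + 2) / \<delta>) ^ k * ((4 * real k + 2) / \<delta>) ^ k"
    using u(2) assms(2) by (intro mult_mono zero_le_power) auto
  then show ?thesis
    by (simp only: M_eq mult_2 power_add)
qed

text \<open>
  A polynomial packing bound of Haussler type, with a cruder exponent: about \<open>2 ln |X| / \<delta>\<close> sample
  points suffice to distinguish all members of the family, and by Sauer-Shelah the number of traces
  on a sample of \<open>m\<close> points is at most \<open>(m + 1)\<^sup>k\<close>.
\<close>

lemma card_separated_family_le:
  fixes f :: "'x \<Rightarrow> 'a set" and \<delta> :: real
  assumes "finite X" "finite E" "0 < \<delta>" "\<delta> \<le> 1" "0 < k"
    and sep: "\<And>x y. x \<in> X \<Longrightarrow> y \<in> X \<Longrightarrow> x \<noteq> y \<Longrightarrow>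
      \<delta> * card E < card {b\<in>E. (b \<in> f x) \<noteq> (b \<in> f y)}"
    and no_shatter: "\<And>T. T \<subseteq> E \<Longrightarrow> card T = k \<Longrightarrow> \<not> shatters (f ` X) T"
  shows "card X \<le> ((4 * real k + 2) / \<delta>) ^ (2 * k)"
proof (cases "card X \<le> 1")
  case True
  have "1 \<le> (4 * real k + 2) / \<delta>" using assms(3,4) by (simp add: le_divide_eq)
  then have "1 \<le> ((4 * real k + 2) / \<delta>) ^ (2 * k)" by (rule one_le_power)
  moreover have "real (card X) \<le> 1" using True by simp
  ultimately show ?thesis by linarith
next
  case False
  then have M: "1 < card X" by simp
  obtain x y where "x \<in> X" "y \<in> X" "x \<noteq> y"
    using card_le_Suc0_iff_eq[OF assms(1)] False by auto
  from sep[OF this] have "E \<noteq> {}" by auto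
  \<comment> \<open>The sample is large enough for the number of undistinguished pairs to drop below \<open>1\<close>.\<close>
  define m where "m = nat \<lfloor>2 * ln (card X) / \<delta>\<rfloor> + 1"
  have "0 \<le> 2 * ln (card X) / \<delta>" using M assms(3) by simp
  then have m: "2 * ln (card X) / \<delta> < m" "m + 1 \<le> 2 * ln (card X) / \<delta> + 2"
    unfolding m_def by linarith+
  have "\<exists>B\<subseteq>E. card B \<le> m \<and>
      card {(x, y). x \<in> X \<and> y \<in> X \<and> x \<noteq> y \<and> f x \<inter> B = f y \<inter> B} \<le> (1 - \<delta>) ^ m * (card X)\<^sup>2"
    using assms(1,2) \<open>E \<noteq> {}\<close> assms(4) less_imp_le[OF sep] by (rule exists_separating_sample)
  then obtain B where B: "B \<subseteq> E" "card B \<le> m"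
    and le: "card {(x, y). x \<in> X \<and> y \<in> X \<and> x \<noteq> y \<and> f x \<inter> B = f y \<inter> B} \<le> (1 - \<delta>) ^ m * (card X)\<^sup>2"
    by (elim exE conjE)
  have "(1 - \<delta>) ^ m \<le> exp (- \<delta>) ^ m"
    using exp_ge_add_one_self[of "- \<delta>"] assms(4) by (intro power_mono) auto
  also have "\<dots> = exp (- (\<delta> * m))" by (simp add: exp_of_nat_mult[symmetric] mult.commute)
  also have "\<dots> < exp (- (2 * ln (card X)))"
    using m(1) assms(3) by (simp add: field_simps)
  also have "\<dots> = 1 / (card X)\<^sup>2"
    using M by (simp add: exp_minus exp_double inverse_eq_divide)
  finally have "(1 - \<delta>) ^ m * (card X)\<^sup>2 < 1"
    using M by (simp add: field_simps)
  with le have "card {(x, y). x \<in> X \<and> y \<in> X \<and> x \<noteq> y \<and> f x \<inter> B = f y \<inter> B} = 0" by simp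
  moreover have "finite {(x, y). x \<in> X \<and> y \<in> X \<and> x \<noteq> y \<and> f x \<inter> B = f y \<inter> B}"
    by (rule finite_subset[of _ "X \<times> X"]) (use assms(1) in auto)
  ultimately have "{(x, y). x \<in> X \<and> y \<in> X \<and> x \<noteq> y \<and> f x \<inter> B = f y \<inter> B} = {}" by simp
  then have inj: "inj_on (\<lambda>x. f x \<inter> B) X" by (auto intro!: inj_onI)
  have "card X = card ((\<lambda>x. f x \<inter> B) ` X)"
    using inj by (simp add: card_image)
  also have "\<dots> \<le> (card B + 1) ^ k"
  proof (rule sauer_shelah)
    show "finite B" using B(1) assms(2) by (rule finite_subset)
    fix T assume T: "T \<subseteq> B" "card T = k"
    show "\<not> shatters ((\<lambda>x. f x \<inter> B) ` X) T"
    proof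
      assume "shatters ((\<lambda>x. f x \<inter> B) ` X) T"
      moreover have "f x \<inter> B \<inter> T = f x \<inter> T" for x using T(1) by blast
      ultimately have "shatters (f ` X) T" by (simp add: shatters_def)
      then show False using no_shatter T B(1) by blast
    qed
  qed auto
  also have "\<dots> \<le> (m + 1) ^ k" using B(2) by (intro power_mono) auto
  finally have "real (card X) \<le> (real m + 1) ^ k"
    by (metis of_nat_1 of_nat_add of_nat_le_iff of_nat_power)
  also have "\<dots> \<le> (2 * ln (card X) / \<delta> + 2) ^ k"
    using m(2) by (intro power_mono) auto
  finally show ?thesis
    using M assms by (intro le_of_le_log_power) auto
qed

section \<open>Almost-periods of a stable set\<close>

locale finite_abelian_group = abelian_group G for G (structure) +
  assumes finite_carrier [simp]: "finite (carrier G)"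
begin

definition translate_dist :: "'a set \<Rightarrow> 'a \<Rightarrow> 'a \<Rightarrow> nat" where
  "translate_dist A x y = card {b \<in> carrier G. (x \<oplus> b \<in> A) \<noteq> (y \<oplus> b \<in> A)}"

lemma translate_dist_sym: "translate_dist A x y = translate_dist A y x"
  unfolding translate_dist_def by (rule arg_cong[where f = card]) blast

lemma card_carrier_pos: "0 < card (carrier G)"
  by (simp add: card_gt_0_iff) blast

lemma translate_dist_shift:
  assumes "x \<in> carrier G" "y \<in> carrier G"
  shows "translate_dist A \<zero> (y \<ominus> x) = translate_dist A x y"
proof -
  have "bij_betw (\<lambda>b. x \<oplus> b) {b \<in> carrier G. (x \<oplus> b \<in> A) \<noteq> (y \<oplus> b \<in> A)}
     {c \<in> carrier G. (\<zero> \<oplus> c \<in> A) \<noteq> ((y \<ominus> x) \<oplus> c \<in> A)}"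
  proof (rule bij_betw_byWitness[where f' = "\<lambda>c. \<ominus> x \<oplus> c"])
    show "\<forall>b\<in>{b \<in> carrier G. (x \<oplus> b \<in> A) \<noteq> (y \<oplus> b \<in> A)}. \<ominus> x \<oplus> (x \<oplus> b) = b"
      using assms by (simp add: r_neg1)
    show "\<forall>c\<in>{c \<in> carrier G. (\<zero> \<oplus> c \<in> A) \<noteq> ((y \<ominus> x) \<oplus> c \<in> A)}. x \<oplus> (\<ominus> x \<oplus> c) = c"
      using assms by (simp add: r_neg2)
    have "(y \<ominus> x) \<oplus> (x \<oplus> b) = y \<oplus> b" if "b \<in> carrier G" for b
      using assms that by (simp add: a_minus_def a_assoc r_neg1)
    then show "(\<oplus>) x ` {b \<in> carrier G. (x \<oplus> b \<in> A) \<noteq> (y \<oplus> b \<in> A)}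
      \<subseteq> {c \<in> carrier G. (\<zero> \<oplus> c \<in> A) \<noteq> ((y \<ominus> x) \<oplus> c \<in> A)}"
      using assms by auto
    have "(y \<ominus> x) \<oplus> c = y \<oplus> (\<ominus> x \<oplus> c)" if "c \<in> carrier G" for c
      using assms that by (simp add: a_minus_def a_assoc)
    then show "(\<lambda>c. \<ominus> x \<oplus> c) ` {c \<in> carrier G. (\<zero> \<oplus> c \<in> A) \<noteq> ((y \<ominus> x) \<oplus> c \<in> A)}
      \<subseteq> {b \<in> carrier G. (x \<oplus> b \<in> A) \<noteq> (y \<oplus> b \<in> A)}"
      using assms by (auto simp: r_neg2)
  qed
  then show ?thesis
    unfolding translate_dist_def by (rule bij_betw_same_card[symmetric])
qed

text \<open>
  If \<open>T = {t\<^sub>1, \<dots>, t\<^sub>k}\<close> is shattered by translates of \<open>A\<close>, then its final segments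
  \<open>{t\<^sub>i, \<dots>, t\<^sub>k}\<close> are cut out by translates, which is the order property.
\<close>

lemma stable_imp_not_shatters:
  assumes stable: "k_stable G k A" and "X \<subseteq> carrier G" "T \<subseteq> carrier G" "card T = k"
  shows "\<not> shatters ((\<lambda>x. {b \<in> carrier G. x \<oplus> b \<in> A}) ` X) T"
proof
  assume sh: "shatters ((\<lambda>x. {b \<in> carrier G. x \<oplus> b \<in> A}) ` X) T"
  have "finite T" using assms(3) by (rule finite_subset) simp
  then obtain t where t: "bij_betw t {1..k} T"
    using ex_bij_betw_nat_finite_1 assms(4) by blast
  have "\<exists>x\<in>X. {b \<in> carrier G. x \<oplus> b \<in> A} \<inter> T = t ` {i..k}" if "i \<in> {1..k}" for i
  proof -
    have "t ` {i..k} \<subseteq> T"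
      using t that unfolding bij_betw_def by auto
    then show ?thesis using sh unfolding shatters_def by auto
  qed
  then obtain a where a: "\<And>i. i \<in> {1..k} \<Longrightarrow> a i \<in> X"
      "\<And>i. i \<in> {1..k} \<Longrightarrow> {b \<in> carrier G. a i \<oplus> b \<in> A} \<inter> T = t ` {i..k}"
    by metis
  have tT: "t i \<in> T" if "i \<in> {1..k}" for i
    using t that by (auto simp: bij_betw_def)
  have "a i \<oplus> t j \<in> A \<longleftrightarrow> i \<le> j" if "i \<in> {1..k}" "j \<in> {1..k}" for i j
  proof -
    have "a i \<oplus> t j \<in> A \<longleftrightarrow> t j \<in> t ` {i..k}"
      using a(2)[OF that(1)] tT[OF that(2)] assms(3) by blast
    also have "\<dots> \<longleftrightarrow> j \<in> {i..k}"
      using t that by (intro inj_on_image_mem_iff[of t "{1..k}"]) (auto simp: bij_betw_def)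
    finally show ?thesis using that by simp
  qed
  then have "order_property G k A"
    unfolding order_property_def using a(1) tT assms(2,3) by blast
  with stable show False by (simp add: k_stable_def)
qed

text \<open>
  Choose a maximal set \<open>X\<close> of elements whose translates of \<open>A\<close> differ pairwise on more than
  \<open>\<delta> |G|\<close> points. By maximality every element of \<open>G\<close> differs from some member of \<open>X\<close> by an
  almost-period, so \<open>|G|\<close> is at most \<open>|X|\<close> times the number of almost-periods.
\<close>

lemma many_almost_periods:
  fixes \<delta> :: real
  assumes stable: "k_stable G k A" and "0 < k" "0 < \<delta>" "\<delta> \<le> 1"
  shows "card (carrier G) \<le> ((4 * real k + 2) / \<delta>) ^ (2 * k) *
    card {h \<in> carrier G. translate_dist A \<zero> h \<le> \<delta> * card (carrier G)}"
proof -
  define S where "S = {h \<in> carrier G. translate_dist A \<zero> h \<le> \<delta> * card (carrier G)}"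
  define separated where "separated X \<longleftrightarrow> X \<subseteq> carrier G \<and>
     (\<forall>x\<in>X. \<forall>y\<in>X. x \<noteq> y \<longrightarrow> \<delta> * card (carrier G) < translate_dist A x y)" for X
  have "finite (Collect separated)"
    by (rule finite_subset[of _ "Pow (carrier G)"]) (auto simp: separated_def)
  moreover have "{} \<in> Collect separated" by (simp add: separated_def)
  ultimately obtain X where X: "separated X" and max: "\<And>Y. separated Y \<Longrightarrow> X \<subseteq> Y \<Longrightarrow> X = Y"
    using finite_has_maximal[of "Collect separated"] by auto
  have XG: "X \<subseteq> carrier G" and finX: "finite X"
    using X finite_subset[OF _ finite_carrier] by (auto simp: separated_def)
  have close: "\<exists>x\<in>X. translate_dist A x v \<le> \<delta> * card (carrier G)" if v: "v \<in> carrier G" for v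
  proof (cases "v \<in> X")
    case True
    then show ?thesis using assms(3) by (intro bexI[of _ v]) (auto simp: translate_dist_def)
  next
    case False
    then have "\<not> separated (insert v X)" using max by blast
    then show ?thesis
      using X v translate_dist_sym unfolding separated_def by (auto simp: not_less)
  qed
  have "carrier G \<subseteq> (\<Union>x\<in>X. (\<lambda>h. h \<oplus> x) ` S)"
  proof
    fix v assume v: "v \<in> carrier G"
    from close[OF this] obtain x where x: "x \<in> X" "translate_dist A x v \<le> \<delta> * card (carrier G)" by blast
    then have xG: "x \<in> carrier G" using XG by blast
    have "v \<ominus> x \<in> S" unfolding S_def using v xG x(2) by (simp add: translate_dist_shift)
    moreover have "v = (v \<ominus> x) \<oplus> x" using v xG by (simp add: a_minus_def a_assoc l_neg)
    ultimately show "v \<in> (\<Union>x\<in>X. (\<lambda>h. h \<oplus> x) ` S)" using x(1) by blast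
  qed
  moreover have finS: "finite S" by (simp add: S_def)
  ultimately have "card (carrier G) \<le> card (\<Union>x\<in>X. (\<lambda>h. h \<oplus> x) ` S)"
    using finX by (intro card_mono) auto
  also have "\<dots> \<le> (\<Sum>x\<in>X. card ((\<lambda>h. h \<oplus> x) ` S))" by (rule card_UN_le[OF finX])
  also have "\<dots> \<le> (\<Sum>x\<in>X. card S)" by (intro sum_mono card_image_le finS)
  finally have "card (carrier G) \<le> card X * card S" by simp
  then have "real (card (carrier G)) \<le> real (card X) * card S"
    by (simp only: of_nat_le_iff of_nat_mult[symmetric])
  also have "card X \<le> ((4 * real k + 2) / \<delta>) ^ (2 * k)"
  proof (rule card_separated_family_le[where f = "\<lambda>x. {b \<in> carrier G. x \<oplus> b \<in> A}" and E = "carrier G"])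
    fix x y assume xy: "x \<in> X" "y \<in> X" "x \<noteq> y"
    have "{b \<in> carrier G. (b \<in> {b \<in> carrier G. x \<oplus> b \<in> A}) \<noteq> (b \<in> {b \<in> carrier G. y \<oplus> b \<in> A})}
       = {b \<in> carrier G. (x \<oplus> b \<in> A) \<noteq> (y \<oplus> b \<in> A)}" by blast
    then show "\<delta> * card (carrier G) < card {b \<in> carrier G. (b \<in> {b \<in> carrier G. x \<oplus> b \<in> A}) \<noteq> (b \<in> {b \<in> carrier G. y \<oplus> b \<in> A})}"
      using X xy unfolding separated_def translate_dist_def by simp
  qed (use assms finX XG stable_imp_not_shatters[OF stable XG] in auto)
  finally show ?thesis unfolding S_def by (simp add: mult_right_mono)
qed

text \<open>
  Take the cosets at least half of which lies in \<open>A\<close>. Every misclassified \<open>x\<close> then disagrees with at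
  least half of its coset, that is, with \<open>h \<oplus> x\<close> for at least half of all \<open>h \<in> H\<close>. Double counting
  the pairs \<open>(x, h)\<close> bounds the number of misclassified points by twice the mean of the distances
  between \<open>A\<close> and its translates by \<open>H\<close>.
\<close>

lemma round_to_cosets:
  fixes \<eta> :: real
  assumes H: "additive_subgroup H G" and A: "A \<subseteq> carrier G"
    and periods: "\<And>h. h \<in> H \<Longrightarrow> translate_dist A \<zero> h \<le> \<eta>"
  shows "\<exists>I \<subseteq> a_rcosets H. card (sym_diff A (\<Union>I)) \<le> 2 * \<eta>"
proof -
  interpret H: additive_subgroup H G by (rule H)
  have HG: "H \<subseteq> carrier G" by (rule H.a_subset)
  have finH: "finite H" using HG finite_carrier by (rule finite_subset)
  define I where "I = {C \<in> a_rcosets H. card C \<le> 2 * card (A \<inter> C)}"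
  define D where "D = sym_diff A (\<Union>I)"
  define B where "B x = {h \<in> H. (\<zero> \<oplus> x \<in> A) \<noteq> (h \<oplus> x \<in> A)}" for x
  have "C \<subseteq> carrier G" if "C \<in> a_rcosets H" for C
    using that HG by (auto simp: A_RCOSETS_def' a_r_coset_def')
  then have DG: "D \<subseteq> carrier G" using A unfolding D_def I_def by blast
  have finD: "finite D" using DG finite_carrier by (rule finite_subset)
  have minority: "card H \<le> 2 * card (B x)" if x: "x \<in> D" for x
  proof -
    have xG: "x \<in> carrier G" using x DG by blast
    define C where "C = H +> x"
    have C_eq: "C = (\<lambda>h. h \<oplus> x) ` H" by (auto simp: C_def a_r_coset_def')
    have inj: "inj_on (\<lambda>h. h \<oplus> x) H"
      using HG xG by (intro inj_onI) (auto dest: add.right_cancel[THEN iffD1, rotated 3])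
    then have card_C: "card C = card H" by (simp add: C_eq card_image)
    have C: "C \<in> a_rcosets H" using xG unfolding C_def by (auto simp: A_RCOSETS_def')
    have xC: "x \<in> C" using xG H.zero_closed unfolding C_eq by (auto intro!: image_eqI[of _ _ \<zero>])
    have card_restrict: "card {h \<in> H. P (h \<oplus> x)} = card {c \<in> C. P c}" for P
    proof -
      have "{c \<in> C. P c} = (\<lambda>h. h \<oplus> x) ` {h \<in> H. P (h \<oplus> x)}" unfolding C_eq by blast
      then show ?thesis by (simp add: card_image inj_on_subset[OF inj])
    qed
    have finC: "finite C" using finH by (simp add: C_eq)
    have split: "card C = card {c \<in> C. c \<in> A} + card {c \<in> C. c \<notin> A}"
      by (subst card_Un_disjoint[symmetric]) (use finC in \<open>auto intro!: arg_cong[where f = card]\<close>)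
    have Int: "A \<inter> C = {c \<in> C. c \<in> A}" by blast
    show ?thesis
    proof (cases "x \<in> A")
      case True
      then have "C \<notin> I" using x xC unfolding D_def by blast
      then have "2 * card {c \<in> C. c \<in> A} < card C" using C by (simp add: I_def Int)
      moreover have "B x = {h \<in> H. h \<oplus> x \<notin> A}" using True xG by (simp add: B_def)
      ultimately show ?thesis using split by (simp add: card_C card_restrict[of "\<lambda>c. c \<notin> A"])
    next
      case False
      then obtain C' where C': "C' \<in> I" "x \<in> C'" using x unfolding D_def by blast
      then obtain y where y: "y \<in> carrier G" "C' = H +> y" by (auto simp: I_def A_RCOSETS_def')
      then have "C' = C"
        using a_repr_independence[OF _ y(1) H.a_subgroup, of x] C' by (simp add: C_def)
      then have "card C \<le> 2 * card {c \<in> C. c \<in> A}" using C' by (simp add: I_def Int)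
      moreover have "B x = {h \<in> H. h \<oplus> x \<in> A}" using False xG by (simp add: B_def)
      ultimately show ?thesis using split by (simp add: card_C card_restrict[of "\<lambda>c. c \<in> A"])
    qed
  qed
  have "card D * card H = (\<Sum>x\<in>D. card H)" by simp
  also have "\<dots> \<le> (\<Sum>x\<in>D. 2 * card (B x))" by (intro sum_mono minority)
  also have "\<dots> = 2 * (\<Sum>x\<in>D. \<Sum>h\<in>H. if (\<zero> \<oplus> x \<in> A) \<noteq> (h \<oplus> x \<in> A) then 1 else 0)"
    unfolding B_def sum_distrib_left[symmetric] using finH by (simp add: sum.If_cases Int_def)
  also have "\<dots> = 2 * (\<Sum>h\<in>H. card {x \<in> D. (\<zero> \<oplus> x \<in> A) \<noteq> (h \<oplus> x \<in> A)})"
    by (subst sum.swap) (use finD in \<open>simp add: sum.If_cases Int_def\<close>)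
  also have "\<dots> \<le> 2 * (\<Sum>h\<in>H. translate_dist A \<zero> h)"
    unfolding translate_dist_def using DG by (intro mult_left_mono sum_mono card_mono) auto
  finally have "real (card D * card H) \<le> real (2 * (\<Sum>h\<in>H. translate_dist A \<zero> h))"
    by (rule of_nat_mono)
  also have "\<dots> = 2 * (\<Sum>h\<in>H. real (translate_dist A \<zero> h))" by simp
  also have "\<dots> \<le> 2 * (\<Sum>h\<in>H. \<eta>)"
    by (intro mult_left_mono sum_mono periods) simp_all
  finally have "real (card H) * card D \<le> real (card H) * (2 * \<eta>)" by (simp add: mult_ac)
  moreover have "0 < card H" using finH H.zero_closed card_gt_0_iff by blast
  ultimately have "card D \<le> 2 * \<eta>" by simp
  moreover have "I \<subseteq> a_rcosets H" by (auto simp: I_def)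
  ultimately show ?thesis unfolding D_def by blast
qed

end

section \<open>Spectral control of the almost-periods\<close>

lemma norm_diff_one_sq:
  assumes "norm (z :: complex) = 1"
  shows "(norm (z - 1))\<^sup>2 = 2 - 2 * Re z"
  using assms cmod_power2[of z] by (simp add: cmod_power2 power2_diff)

text \<open>
  A finite family of characters with the second orthogonality relation, that is, the full dual group
  of \<open>G\<close>, so that Parseval's identity holds.
\<close>

locale orthogonal_characters = finite_abelian_group +
  fixes \<Xi> :: "'i set" and \<chi> :: "'i \<Rightarrow> 'a \<Rightarrow> complex"
  assumes finite_index [simp]: "finite \<Xi>"
    and char_add: "\<lbrakk>\<xi> \<in> \<Xi>; x \<in> carrier G; y \<in> carrier G\<rbrakk> \<Longrightarrow> \<chi> \<xi> (x \<oplus> y) = \<chi> \<xi> x * \<chi> \<xi> y"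
    and norm_char: "\<lbrakk>\<xi> \<in> \<Xi>; x \<in> carrier G\<rbrakk> \<Longrightarrow> norm (\<chi> \<xi> x) = 1"
    and sum_char: "x \<in> carrier G \<Longrightarrow> (\<Sum>\<xi>\<in>\<Xi>. \<chi> \<xi> x) = (if x = \<zero> then of_nat (card (carrier G)) else 0)"
begin

lemma char_minus:
  assumes "\<xi> \<in> \<Xi>" "x \<in> carrier G" "y \<in> carrier G"
  shows "\<chi> \<xi> (x \<ominus> y) = \<chi> \<xi> x * cnj (\<chi> \<xi> y)"
proof -
  have "x = (x \<ominus> y) \<oplus> y" using assms by (simp add: a_minus_def a_assoc l_neg)
  then have "\<chi> \<xi> x = \<chi> \<xi> (x \<ominus> y) * \<chi> \<xi> y"
    using assms char_add by (metis minus_closed)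
  moreover have "\<chi> \<xi> y * cnj (\<chi> \<xi> y) = 1"
    using assms by (simp add: complex_norm_square[symmetric] norm_char)
  ultimately show ?thesis by (simp add: mult.assoc)
qed

lemma parseval:
  fixes g :: "'a \<Rightarrow> real"
  shows "(\<Sum>\<xi>\<in>\<Xi>. (norm (\<Sum>x\<in>carrier G. g x * \<chi> \<xi> x))\<^sup>2) = card (carrier G) * (\<Sum>x\<in>carrier G. (g x)\<^sup>2)"
proof -
  have "complex_of_real (\<Sum>\<xi>\<in>\<Xi>. (norm (\<Sum>x\<in>carrier G. g x * \<chi> \<xi> x))\<^sup>2)
      = (\<Sum>\<xi>\<in>\<Xi>. \<Sum>x\<in>carrier G. \<Sum>y\<in>carrier G. g x * g y * \<chi> \<xi> (x \<ominus> y))"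
    by (simp only: of_real_sum complex_norm_square) (simp add: sum_product char_minus mult_ac)
  also have "\<dots> = (\<Sum>x\<in>carrier G. \<Sum>y\<in>carrier G. g x * g y * (\<Sum>\<xi>\<in>\<Xi>. \<chi> \<xi> (x \<ominus> y)))"
    by (subst sum.swap, rule sum.cong, simp, subst sum.swap) (simp add: sum_distrib_left)
  also have "\<dots> = (\<Sum>x\<in>carrier G. \<Sum>y\<in>carrier G. 
      if x = y then complex_of_real (card (carrier G) * (g x)\<^sup>2) else 0)"
    by (intro sum.cong refl) (auto simp: sum_char power2_eq_square)
  also have "\<dots> = complex_of_real (card (carrier G) * (\<Sum>x\<in>carrier G. (g x)\<^sup>2))"
    by (simp add: sum_distrib_left)
  finally show ?thesis by (simp only: of_real_eq_iff)
qed

definition spectral_weight :: "'a set \<Rightarrow> 'i \<Rightarrow> real" where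
  "spectral_weight A \<xi> = (norm (\<Sum>x\<in>carrier G. indicator A x * \<chi> \<xi> x))\<^sup>2"

text \<open>
  Parseval for the difference of the indicator functions of \<open>A\<close> and of its translate by \<open>h\<close>: translation
  multiplies the Fourier coefficient at \<open>\<xi>\<close> by the conjugate of \<open>\<chi> \<xi> h\<close>.
\<close>

lemma translate_dist_spectral:
  assumes h: "h \<in> carrier G"
  shows "real (card (carrier G)) * real (translate_dist A \<zero> h) = (\<Sum>\<xi>\<in>\<Xi>. spectral_weight A \<xi> * (norm (\<chi> \<xi> h - 1))\<^sup>2)"
proof -
  define g :: "'a \<Rightarrow> real" where "g x = indicator A (h \<oplus> x) - indicator A x" for x
  have "(\<Sum>x\<in>carrier G. (g x)\<^sup>2) = (\<Sum>x\<in>carrier G. if (\<zero> \<oplus> x \<in> A) \<noteq> (h \<oplus> x \<in> A) then 1 else 0)"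
    by (intro sum.cong) (auto simp: g_def indicator_def)
  also have "\<dots> = translate_dist A \<zero> h"
    by (simp add: translate_dist_def sum.If_cases Int_def cong: conj_cong)
  finally have g2: "(\<Sum>x\<in>carrier G. (g x)\<^sup>2) = translate_dist A \<zero> h" .
  have "(norm (\<Sum>x\<in>carrier G. g x * \<chi> \<xi> x))\<^sup>2 = spectral_weight A \<xi> * (norm (\<chi> \<xi> h - 1))\<^sup>2"
    if \<xi>: "\<xi> \<in> \<Xi>" for \<xi>
  proof -
    have bij: "bij_betw (\<lambda>x. h \<oplus> x) (carrier G) (carrier G)"
      by (rule bij_betw_byWitness[where f' = "\<lambda>x. \<ominus> h \<oplus> x"]) (use h in \<open>auto simp: r_neg1 r_neg2\<close>)
    have "(\<Sum>x\<in>carrier G. indicator A (h \<oplus> x) * \<chi> \<xi> x)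
        = (\<Sum>x\<in>carrier G. indicator A (h \<oplus> x) * \<chi> \<xi> (h \<oplus> x \<ominus> h))"
    proof (intro sum.cong refl)
      fix x assume "x \<in> carrier G"
      then have "h \<oplus> x \<ominus> h = x" using h by (simp add: a_minus_def a_comm[of h x] a_assoc r_neg)
      then show "indicator A (h \<oplus> x) * \<chi> \<xi> x = indicator A (h \<oplus> x) * \<chi> \<xi> (h \<oplus> x \<ominus> h)" by simp
    qed
    also have "\<dots> = (\<Sum>x\<in>carrier G. indicator A x * \<chi> \<xi> (x \<ominus> h))"
      by (rule sum.reindex_bij_betw[OF bij])
    also have "\<dots> = cnj (\<chi> \<xi> h) * (\<Sum>x\<in>carrier G. indicator A x * \<chi> \<xi> x)"
      using \<xi> h by (simp add: char_minus sum_distrib_left mult_ac)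
    finally have shift: "(\<Sum>x\<in>carrier G. indicator A (h \<oplus> x) * \<chi> \<xi> x)
      = cnj (\<chi> \<xi> h) * (\<Sum>x\<in>carrier G. indicator A x * \<chi> \<xi> x)" .
    have ind: "complex_of_real (indicator A x) = indicator A x" for x by (simp add: indicator_def)
    have "(\<Sum>x\<in>carrier G. g x * \<chi> \<xi> x) = cnj (\<chi> \<xi> h - 1) * (\<Sum>x\<in>carrier G. indicator A x * \<chi> \<xi> x)"
      by (simp add: g_def ind left_diff_distrib sum_subtractf shift)
    then show ?thesis
      by (simp add: spectral_weight_def norm_mult power_mult_distrib mult.commute del: complex_cnj_diff)
  qed
  then show ?thesis using parseval[of g] by (simp add: g2)
qed

text \<open>
  The step from a dense set of almost-periods to a subgroup of them, in the spirit of Bogolyubov's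
  lemma. The characters in \<open>\<Gamma>\<close> are those that correlate with \<open>S\<close>; there are few of them by Parseval.
  The other characters are far from \<open>1\<close> on average over \<open>S\<close>, so the almost-periodicity of \<open>A\<close> along
  \<open>S\<close> leaves little spectral weight on them, and this weight bounds the distance for every \<open>h\<close>
  at which all characters in \<open>\<Gamma>\<close> are trivial.
\<close>

lemma few_characters_control_periods:
  fixes \<delta> :: real
  assumes S: "S \<subseteq> carrier G" "S \<noteq> {}"
    and periods: "\<And>h. h \<in> S \<Longrightarrow> translate_dist A \<zero> h \<le> \<delta> * card (carrier G)"
  shows "\<exists>\<Gamma>\<subseteq>\<Xi>. card \<Gamma> * card S \<le> 4 * card (carrier G) \<and>
    (\<forall>h\<in>carrier G. (\<forall>\<xi>\<in>\<Gamma>. \<chi> \<xi> h = 1) \<longrightarrow> translate_dist A \<zero> h \<le> 4 * \<delta> * card (carrier G))"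
proof -
  let ?N = "real (card (carrier G))"
  let ?w = "spectral_weight A"
  have finS: "finite S" using S(1) finite_carrier by (rule finite_subset)
  have S_pos: "0 < real (card S)" using finS S(2) by (simp add: card_gt_0_iff)
  define \<Gamma> where "\<Gamma> = {\<xi> \<in> \<Xi>. card S / 2 \<le> Re (\<Sum>h\<in>S. \<chi> \<xi> h)}"
  have \<Gamma>: "\<Gamma> \<subseteq> \<Xi>" by (auto simp: \<Gamma>_def)
  have w_nonneg: "0 \<le> ?w \<xi>" for \<xi> by (simp add: spectral_weight_def)
  have "card \<Gamma> * (card S / 2)\<^sup>2 = (\<Sum>\<xi>\<in>\<Gamma>. (card S / 2)\<^sup>2)" by simp
  also have "\<dots> \<le> (\<Sum>\<xi>\<in>\<Gamma>. (norm (\<Sum>h\<in>S. \<chi> \<xi> h))\<^sup>2)"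
  proof (intro sum_mono power_mono)
    fix \<xi> assume "\<xi> \<in> \<Gamma>"
    then show "card S / 2 \<le> norm (\<Sum>h\<in>S. \<chi> \<xi> h)"
      using complex_Re_le_cmod[of "\<Sum>h\<in>S. \<chi> \<xi> h"] unfolding \<Gamma>_def by auto
  qed auto
  also have "\<dots> \<le> (\<Sum>\<xi>\<in>\<Xi>. (norm (\<Sum>h\<in>S. \<chi> \<xi> h))\<^sup>2)"
    using \<Gamma> by (intro sum_mono2) auto
  also have "\<dots> = (\<Sum>\<xi>\<in>\<Xi>. (norm (\<Sum>x\<in>carrier G. indicat_real S x * \<chi> \<xi> x))\<^sup>2)"
  proof (intro sum.cong refl)
    fix \<xi>
    have "(\<Sum>x\<in>carrier G. indicat_real S x * \<chi> \<xi> x) = (\<Sum>x\<in>S. \<chi> \<xi> x)"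
      using S(1) by (intro sum.mono_neutral_cong_right) auto
    then show "(norm (\<Sum>h\<in>S. \<chi> \<xi> h))\<^sup>2 = (norm (\<Sum>x\<in>carrier G. indicat_real S x * \<chi> \<xi> x))\<^sup>2" by simp
  qed
  also have "\<dots> = ?N * (\<Sum>x\<in>carrier G. (indicat_real S x)\<^sup>2)" by (rule parseval)
  also have "(\<Sum>x\<in>carrier G. (indicat_real S x)\<^sup>2) = (\<Sum>x\<in>S. 1)"
    using S(1) by (intro sum.mono_neutral_cong_right) auto
  finally have "(card \<Gamma> * card S) * real (card S) \<le> (4 * ?N) * card S"
    by (simp add: power2_eq_square mult_ac)
  then have few: "card \<Gamma> * card S \<le> 4 * ?N" using S_pos by simp
  have tail: "(\<Sum>\<xi>\<in>\<Xi> - \<Gamma>. ?w \<xi>) \<le> \<delta> * ?N * ?N"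
  proof -
    have "card S * (\<Sum>\<xi>\<in>\<Xi> - \<Gamma>. ?w \<xi>) = (\<Sum>\<xi>\<in>\<Xi> - \<Gamma>. ?w \<xi> * card S)"
      by (simp add: sum_distrib_left mult.commute)
    also have "\<dots> \<le> (\<Sum>\<xi>\<in>\<Xi> - \<Gamma>. ?w \<xi> * (\<Sum>h\<in>S. (norm (\<chi> \<xi> h - 1))\<^sup>2))"
    proof (intro sum_mono mult_left_mono w_nonneg)
      fix \<xi> assume \<xi>: "\<xi> \<in> \<Xi> - \<Gamma>"
      have "(\<Sum>h\<in>S. (norm (\<chi> \<xi> h - 1))\<^sup>2) = (\<Sum>h\<in>S. 2 - 2 * Re (\<chi> \<xi> h))"
        using \<xi> S(1) by (intro sum.cong refl norm_diff_one_sq norm_char) auto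
      also have "\<dots> = 2 * card S - 2 * Re (\<Sum>h\<in>S. \<chi> \<xi> h)"
        by (simp add: sum_subtractf sum_distrib_left)
      finally show "real (card S) \<le> (\<Sum>h\<in>S. (norm (\<chi> \<xi> h - 1))\<^sup>2)"
        using \<xi> by (auto simp: \<Gamma>_def not_le)
    qed
    also have "\<dots> \<le> (\<Sum>\<xi>\<in>\<Xi>. ?w \<xi> * (\<Sum>h\<in>S. (norm (\<chi> \<xi> h - 1))\<^sup>2))"
      by (intro sum_mono2) (auto simp: w_nonneg sum_nonneg)
    also have "\<dots> = (\<Sum>h\<in>S. \<Sum>\<xi>\<in>\<Xi>. ?w \<xi> * (norm (\<chi> \<xi> h - 1))\<^sup>2)"
      by (simp add: sum_distrib_left, rule sum.swap)
    also have "\<dots> = (\<Sum>h\<in>S. ?N * translate_dist A \<zero> h)"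
      using S(1) by (intro sum.cong refl) (auto simp: translate_dist_spectral[symmetric])
    also have "\<dots> \<le> (\<Sum>h\<in>S. ?N * (\<delta> * ?N))"
      using periods by (intro sum_mono mult_left_mono) auto
    finally show ?thesis using S_pos by (simp add: mult_ac)
  qed
  have "translate_dist A \<zero> h \<le> 4 * \<delta> * ?N" if h: "h \<in> carrier G" "\<forall>\<xi>\<in>\<Gamma>. \<chi> \<xi> h = 1" for h
  proof -
    have "?N * translate_dist A \<zero> h = (\<Sum>\<xi>\<in>\<Xi> - \<Gamma>. ?w \<xi> * (norm (\<chi> \<xi> h - 1))\<^sup>2)"
      unfolding translate_dist_spectral[OF h(1)]
      by (rule sum.mono_neutral_right) (use h(2) in auto)
    also have "\<dots> \<le> (\<Sum>\<xi>\<in>\<Xi> - \<Gamma>. ?w \<xi> * 4)"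
    proof (intro sum_mono mult_left_mono w_nonneg)
      fix \<xi> assume "\<xi> \<in> \<Xi> - \<Gamma>"
      then have n: "norm (\<chi> \<xi> h) = 1" using h(1) by (simp add: norm_char)
      then show "(norm (\<chi> \<xi> h - 1))\<^sup>2 \<le> 4"
        using abs_Re_le_cmod[of "\<chi> \<xi> h"] by (simp add: norm_diff_one_sq)
    qed
    also have "\<dots> \<le> \<delta> * ?N * ?N * 4"
      unfolding sum_distrib_right[symmetric] using tail by simp
    finally have "?N * translate_dist A \<zero> h \<le> ?N * (4 * \<delta> * ?N)" by (simp add: mult_ac)
    then show ?thesis using card_carrier_pos by simp
  qed
  with few \<Gamma> show ?thesis
    by (intro exI[of _ \<Gamma>]) (metis (mono_tags, lifting) of_nat_le_iff of_nat_mult of_nat_numeral)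
qed

end

section \<open>Codimension by counting\<close>

lemma (in vectorspace) card_carrier_eq_power_dim:
  assumes "finite (carrier K)" "fin_dim"
  shows "card (carrier V) = card (carrier K) ^ dim"
proof -
  obtain B where B: "finite B" "basis B"
    using finite_basis_exists[OF assms(2)] by blast
  then have BV: "B \<subseteq> carrier V" by (simp add: basis_def)
  have unique: "\<exists>!a. a \<in> B \<rightarrow>\<^sub>E carrier K \<and> lincomb a B = v" if "v \<in> carrier V" for v
    using basis_criterion[OF B(1) BV] B(2) that by blast
  have "bij_betw (\<lambda>a. lincomb a B) (B \<rightarrow>\<^sub>E carrier K) (carrier V)"
  proof (rule bij_betwI')
    fix a b assume ab: "a \<in> B \<rightarrow>\<^sub>E carrier K" "b \<in> B \<rightarrow>\<^sub>E carrier K"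
    have "lincomb b B \<in> carrier V"
      using ab(2) BV by (intro lincomb_closed) auto
    then show "(lincomb a B = lincomb b B) = (a = b)"
      using unique ab by metis
  next
    fix a assume "a \<in> B \<rightarrow>\<^sub>E carrier K"
    then show "lincomb a B \<in> carrier V"
      using BV by (intro lincomb_closed) auto
  next
    fix v assume "v \<in> carrier V"
    then show "\<exists>a\<in>B \<rightarrow>\<^sub>E carrier K. v = lincomb a B" using unique by blast
  qed
  then have "card (carrier V) = card (B \<rightarrow>\<^sub>E carrier K)"
    by (rule bij_betw_same_card[symmetric])
  also have "\<dots> = card (carrier K) ^ card B"
    using B(1) by (simp add: card_PiE)
  finally show ?thesis using dim_basis[OF B] by simp
qed

lemma (in vectorspace) finite_imp_fin_dim:
  assumes "finite (carrier V)"
  shows "fin_dim"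
  unfolding fin_dim_def
proof (intro exI conjI)
  show "gen_set (carrier V)"
    using in_own_span[of "carrier V"] span_is_subset2[of "carrier V"] by blast
qed (use assms in auto)

text \<open>
  Over a finite field the dimension is the logarithm of the cardinality, so a codimension bound
  amounts to a bound on the index.
\<close>

lemma (in vectorspace) codim_le_of_card_le:
  assumes "finite (carrier K)" "finite (carrier V)" "VectorSpace.subspace K H V"
    and le: "card (carrier V) \<le> card H * card (carrier K) ^ m"
  shows "codim K V H \<le> m"
proof -
  interpret H: vectorspace K "V\<lparr>carrier := H\<rparr>" using assms(3) by (rule subspace_is_vs)
  have "H \<subseteq> carrier V"
    using assms(3) by (simp add: VectorSpace.subspace_def submodule_def)
  then have "finite H" using assms(2) by (rule finite_subset)
  then have "card H = card (carrier K) ^ vectorspace.dim K (V\<lparr>carrier := H\<rparr>)"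
    using H.card_carrier_eq_power_dim[OF assms(1) H.finite_imp_fin_dim] by simp
  moreover have "card (carrier V) = card (carrier K) ^ dim"
    using card_carrier_eq_power_dim[OF assms(1) finite_imp_fin_dim[OF assms(2)]] .
  ultimately have "card (carrier K) ^ dim \<le> card (carrier K) ^ (vectorspace.dim K (V\<lparr>carrier := H\<rparr>) + m)"
    using le by (simp add: power_add)
  moreover have "1 < card (carrier K)"
  proof -
    have "card {\<zero>\<^bsub>K\<^esub>, \<one>\<^bsub>K\<^esub>} \<le> card (carrier K)"
      using assms(1) by (intro card_mono) auto
    moreover have "\<zero>\<^bsub>K\<^esub> \<noteq> \<one>\<^bsub>K\<^esub>" using zero_not_one by simp
    ultimately show ?thesis by simp
  qed
  ultimately show ?thesis
    unfolding codim_def by (simp add: power_increasing_iff)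
qed

context orthogonal_characters
begin

lemma char_zero:
  assumes "\<xi> \<in> \<Xi>"
  shows "\<chi> \<xi> \<zero> = 1"
  using char_minus[OF assms zero_closed zero_closed]
  unfolding a_minus_def r_neg[OF zero_closed]
  by (simp add: complex_norm_square[symmetric] norm_char assms)

lemma annihilator_additive_subgroup:
  assumes "\<Gamma> \<subseteq> \<Xi>"
  shows "additive_subgroup {x \<in> carrier G. \<forall>\<xi>\<in>\<Gamma>. \<chi> \<xi> x = 1} G"
proof (intro additive_subgroup.intro add.subgroupI)
  have \<Gamma>: "\<xi> \<in> \<Xi>" if "\<xi> \<in> \<Gamma>" for \<xi> using assms that by blast
  show "{x \<in> carrier G. \<forall>\<xi>\<in>\<Gamma>. \<chi> \<xi> x = 1} \<noteq> {}"
    using char_zero \<Gamma> zero_closed by blast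
  fix x assume x: "x \<in> {x \<in> carrier G. \<forall>\<xi>\<in>\<Gamma>. \<chi> \<xi> x = 1}"
  have "\<chi> \<xi> (\<ominus> x) = 1" if "\<xi> \<in> \<Gamma>" for \<xi>
    using char_minus[OF \<Gamma>[OF that] zero_closed, of x] x that by (simp add: char_zero \<Gamma> a_minus_def)
  then show "\<ominus> x \<in> {x \<in> carrier G. \<forall>\<xi>\<in>\<Gamma>. \<chi> \<xi> x = 1}" using x by simp
  fix y assume y: "y \<in> {x \<in> carrier G. \<forall>\<xi>\<in>\<Gamma>. \<chi> \<xi> x = 1}"
  show "x \<oplus> y \<in> {x \<in> carrier G. \<forall>\<xi>\<in>\<Gamma>. \<chi> \<xi> x = 1}" using x y by (simp add: char_add \<Gamma>)
qed auto

text \<open>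
  The fibres of the map \<open>x \<mapsto> (\<chi> \<xi> x)\<close>, \<open>\<xi> \<in> \<Gamma>\<close>, embed into the annihilator by subtracting a
  fixed element of the fibre.
\<close>

lemma card_le_card_annihilator:
  assumes \<Gamma>: "\<Gamma> \<subseteq> \<Xi>" and R: "finite R" "\<And>\<xi> x. \<xi> \<in> \<Gamma> \<Longrightarrow> x \<in> carrier G \<Longrightarrow> \<chi> \<xi> x \<in> R"
  shows "card (carrier G) \<le> card {x \<in> carrier G. \<forall>\<xi>\<in>\<Gamma>. \<chi> \<xi> x = 1} * card R ^ card \<Gamma>"
proof -
  define H where "H = {x \<in> carrier G. \<forall>\<xi>\<in>\<Gamma>. \<chi> \<xi> x = 1}"
  define \<Phi> where "\<Phi> x = (\<lambda>\<xi>\<in>\<Gamma>. \<chi> \<xi> x)" for x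
  have fin\<Gamma>: "finite \<Gamma>" using \<Gamma> finite_index by (rule finite_subset)
  have finH: "finite H" by (simp add: H_def)
  have "\<Phi> ` carrier G \<subseteq> \<Gamma> \<rightarrow>\<^sub>E R" using R(2) by (auto simp: \<Phi>_def)
  then have "card (\<Phi> ` carrier G) \<le> card (\<Gamma> \<rightarrow>\<^sub>E R)"
    by (intro card_mono finite_PiE fin\<Gamma> R(1))
  also have "\<dots> = card R ^ card \<Gamma>" by (simp add: card_PiE[OF fin\<Gamma>])
  finally have card_values: "card (\<Phi> ` carrier G) \<le> card R ^ card \<Gamma>" .
  have fibre: "card {x \<in> carrier G. \<Phi> x = v} \<le> card H" if "v \<in> \<Phi> ` carrier G" for v
  proof -
    from that obtain y where y: "v = \<Phi> y" "y \<in> carrier G" by (rule imageE)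
    show ?thesis
    proof (rule card_inj_on_le)
      show "inj_on (\<lambda>x. x \<ominus> y) {x \<in> carrier G. \<Phi> x = v}"
        using y(2) by (intro inj_onI) (simp add: a_minus_def)
      show "(\<lambda>x. x \<ominus> y) ` {x \<in> carrier G. \<Phi> x = v} \<subseteq> H"
      proof (rule image_subsetI)
        fix x assume "x \<in> {x \<in> carrier G. \<Phi> x = v}"
        then have x: "x \<in> carrier G" "\<Phi> x = \<Phi> y" by (simp_all add: y(1))
        have "\<chi> \<xi> (x \<ominus> y) = 1" if \<xi>: "\<xi> \<in> \<Gamma>" for \<xi>
        proof -
          have "\<chi> \<xi> x = \<chi> \<xi> y" using fun_cong[OF x(2), of \<xi>] \<xi> by (simp add: \<Phi>_def)
          moreover have "\<xi> \<in> \<Xi>" using \<xi> \<Gamma> by blast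
          ultimately show ?thesis
            using x y(2) by (simp add: char_minus complex_norm_square[symmetric] norm_char)
        qed
        then show "x \<ominus> y \<in> H" using x y(2) by (simp add: H_def)
      qed
    qed (rule finH)
  qed
  have "carrier G = (\<Union>v\<in>\<Phi> ` carrier G. {x \<in> carrier G. \<Phi> x = v})" by blast
  then have "card (carrier G) \<le> (\<Sum>v\<in>\<Phi> ` carrier G. card {x \<in> carrier G. \<Phi> x = v})"
    using card_UN_le[of "\<Phi> ` carrier G" "\<lambda>v. {x \<in> carrier G. \<Phi> x = v}"] by simp
  also have "\<dots> \<le> (\<Sum>v\<in>\<Phi> ` carrier G. card H)" by (intro sum_mono fibre)
  also have "\<dots> \<le> card H * card R ^ card \<Gamma>" using card_values by simp
  finally show ?thesis by (simp add: H_def)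
qed

end

section \<open>Characters of the space of tuples\<close>

definition root_char :: "nat \<Rightarrow> int \<Rightarrow> complex" where
  "root_char p a = cis (2 * pi * real_of_int a / real p)"

lemma root_char_add: "root_char p (a + b) = root_char p a * root_char p b"
  by (simp add: root_char_def cis_mult ring_distribs add_divide_distrib)

lemma root_char_0 [simp]: "root_char p 0 = 1"
  by (simp add: root_char_def)

lemma norm_root_char [simp]: "norm (root_char p a) = 1"
  by (simp add: root_char_def)

lemma root_char_of_nat_mult: "root_char p (int c * a) = root_char p a ^ c"
  by (simp add: root_char_def DeMoivre mult_ac)

lemma root_char_multiple:
  assumes "0 < p"
  shows "root_char p (int p * a) = 1"
proof -
  have "2 * pi * real_of_int (int p * a) / real p = 2 * pi * real_of_int a"
    using assms by simp
  then show ?thesis by (simp add: root_char_def)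
qed

lemma root_char_mod:
  assumes "0 < p"
  shows "root_char p (a mod int p) = root_char p a"
proof -
  have "root_char p a = root_char p (int p * (a div int p) + a mod int p)" by simp
  also have "\<dots> = root_char p (a mod int p)"
    by (simp only: root_char_add root_char_multiple[OF assms] mult_1_left)
  finally show ?thesis by simp
qed

lemma root_char_mult_mod:
  assumes "0 < p"
  shows "root_char p (a * (b mod int p)) = root_char p (a * b)"
  using root_char_mod[OF assms, of "a * (b mod int p)"] root_char_mod[OF assms, of "a * b"]
  by (simp add: mod_mult_right_eq)

lemma sum_root_char:
  assumes p: "0 < p" and a: "0 \<le> a" "a < int p"
  shows "(\<Sum>c\<in>{0..int p - 1}. root_char p (c * a)) = (if a = 0 then of_nat p else 0)"
proof (cases "a = 0")
  case False
  define z where "z = root_char p a"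
  have "z ^ p = 1"
    using root_char_of_nat_mult[of p p a] root_char_multiple[OF p, of a] by (simp add: z_def)
  have "z \<noteq> 1"
  proof
    assume "z = 1"
    have "inj_on (\<lambda>k. cis (2 * pi * real k / real p)) {..<p}"
      using bij_betw_roots_unity[OF p] by (rule bij_betw_imp_inj_on)
    moreover have "cis (2 * pi * real (nat a) / real p) = cis (2 * pi * real 0 / real p)"
      using \<open>z = 1\<close> a by (simp add: z_def root_char_def)
    ultimately have "nat a = 0"
      by (rule inj_onD) (use a p in auto)
    then show False using False a by simp
  qed
  have "(\<Sum>c\<in>{0..int p - 1}. root_char p (c * a)) = (\<Sum>c<p. root_char p (int c * a))"
    by (rule sum.reindex_bij_witness[where i = int and j = nat]) auto
  also have "\<dots> = (\<Sum>c<p. z ^ c)" by (simp add: root_char_of_nat_mult z_def)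
  also have "\<dots> = 0" using \<open>z \<noteq> 1\<close> \<open>z ^ p = 1\<close> by (simp add: geometric_sum)
  finally show ?thesis using False by simp
qed (use p in simp)

definition tuple_char :: "nat \<Rightarrow> nat \<Rightarrow> (nat \<Rightarrow> int) \<Rightarrow> (nat \<Rightarrow> int) \<Rightarrow> complex" where
  "tuple_char p n \<xi> x = (\<Prod>i<n. root_char p (\<xi> i * x i))"

lemma tuple_char_add:
  assumes "0 < p"
  shows "tuple_char p n \<xi> (\<lambda>i\<in>{..<n}. (x i + y i) mod int p) = tuple_char p n \<xi> x * tuple_char p n \<xi> y"
  by (simp add: tuple_char_def root_char_mult_mod[OF assms] ring_distribs root_char_add prod.distrib)

lemma tuple_char_smult:
  assumes "0 < p" "0 \<le> c"
  shows "tuple_char p n \<xi> (\<lambda>i\<in>{..<n}. (c * x i) mod int p) = tuple_char p n \<xi> x ^ nat c"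
proof -
  have "root_char p (\<xi> i * ((c * x i) mod int p)) = root_char p (\<xi> i * x i) ^ nat c" for i
    using assms(2) root_char_of_nat_mult[of p "nat c" "\<xi> i * x i"]
    by (simp add: root_char_mult_mod[OF assms(1)] mult_ac)
  then show ?thesis by (simp add: tuple_char_def prod_power_distrib)
qed

lemma tuple_char_power:
  assumes "0 < p"
  shows "tuple_char p n \<xi> x ^ p = 1"
proof -
  have "root_char p (\<xi> i * x i) ^ p = 1" for i
    using root_char_of_nat_mult[of p p] root_char_multiple[OF assms] by metis
  then show ?thesis by (simp add: tuple_char_def prod_power_distrib)
qed

lemma
  assumes "prime p"
  shows carrier_prime_field_power: "carrier (prime_field_power p n) = {..<n} \<rightarrow>\<^sub>E {0..int p - 1}"
    and zero_prime_field_power: "\<zero>\<^bsub>prime_field_power p n\<^esub> = (\<lambda>i\<in>{..<n}. 0)"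
    and add_prime_field_power: "x \<oplus>\<^bsub>prime_field_power p n\<^esub> y = (\<lambda>i\<in>{..<n}. (x i + y i) mod int p)"
    and smult_prime_field_power: "c \<odot>\<^bsub>prime_field_power p n\<^esub> x = (\<lambda>i\<in>{..<n}. (c * x i) mod int p)"
proof -
  interpret residues_prime p "prime_field p"
    using assms by (simp add: residues_prime_def)
  show "carrier (prime_field_power p n) = {..<n} \<rightarrow>\<^sub>E {0..int p - 1}"
    "\<zero>\<^bsub>prime_field_power p n\<^esub> = (\<lambda>i\<in>{..<n}. 0)"
    "x \<oplus>\<^bsub>prime_field_power p n\<^esub> y = (\<lambda>i\<in>{..<n}. (x i + y i) mod int p)"
    "c \<odot>\<^bsub>prime_field_power p n\<^esub> x = (\<lambda>i\<in>{..<n}. (c * x i) mod int p)"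
    by (simp_all add: prime_field_power_def func_space_def) (simp_all add: residue_ring_def)
qed

text \<open>
  The space of tuples is indexed by itself: the sum of \<open>tuple_char p n \<xi> x\<close> over all \<open>\<xi>\<close> factors into
  one sum of \<open>p\<close>-th roots of unity for each coordinate of \<open>x\<close>.
\<close>

lemma orthogonal_characters_tuple_char:
  assumes p: "prime p"
  shows "orthogonal_characters (prime_field_power p n) (carrier (prime_field_power p n)) (tuple_char p n)"
proof -
  interpret V: vectorspace "prime_field p" "prime_field_power p n"
    using p by (rule vectorspace_prime_field_power)
  have p0: "0 < p" using p by (rule prime_gt_0_nat)
  note simps = carrier_prime_field_power[OF p] zero_prime_field_power[OF p] add_prime_field_power[OF p]
  show ?thesis
  proof (unfold_locales)
    show fin: "finite (carrier (prime_field_power p n))"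
      by (simp add: simps finite_PiE)
    fix x assume x: "x \<in> carrier (prime_field_power p n)"
    have range: "0 \<le> x i" "x i < int p" if "i < n" for i
      using x that by (force simp: simps)+
    have "(\<Sum>\<xi>\<in>carrier (prime_field_power p n). tuple_char p n \<xi> x)
        = (\<Prod>i<n. \<Sum>c\<in>{0..int p - 1}. root_char p (c * x i))"
      unfolding tuple_char_def simps by (rule prod_sum_PiE[symmetric]) auto
    also have "\<dots> = (\<Prod>i<n. if x i = 0 then of_nat p else 0)"
      using range by (intro prod.cong refl sum_root_char[OF p0]) auto
    also have "\<dots> = (if \<forall>i<n. x i = 0 then of_nat p ^ n else 0)"
      by auto
    also have "(\<forall>i<n. x i = 0) \<longleftrightarrow> x = \<zero>\<^bsub>prime_field_power p n\<^esub>"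
    proof
      assume "\<forall>i<n. x i = 0"
      then show "x = \<zero>\<^bsub>prime_field_power p n\<^esub>"
        using x unfolding simps by (intro ext) (auto simp: PiE_def extensional_def)
    qed (auto simp: simps)
    finally show "(\<Sum>\<xi>\<in>carrier (prime_field_power p n). tuple_char p n \<xi> x)
        = (if x = \<zero>\<^bsub>prime_field_power p n\<^esub> then of_nat (card (carrier (prime_field_power p n))) else 0)"
      by (simp add: card_prime_field_power[OF p])
  qed (auto simp: add_prime_field_power[OF p] tuple_char_add[OF p0], simp_all add: tuple_char_def prod_norm[symmetric])
qed

lemma annihilator_subspace:
  assumes p: "prime p"
  shows "VectorSpace.subspace (prime_field p)
    {x \<in> carrier (prime_field_power p n). \<forall>\<xi>\<in>\<Gamma>. tuple_char p n \<xi> x = 1} (prime_field_power p n)"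
proof -
  interpret V: vectorspace "prime_field p" "prime_field_power p n"
    using p by (rule vectorspace_prime_field_power)
  have p0: "0 < p" using p by (rule prime_gt_0_nat)
  have zero: "tuple_char p n \<xi> \<zero>\<^bsub>prime_field_power p n\<^esub> = 1" for \<xi>
    by (simp add: tuple_char_def zero_prime_field_power[OF p])
  have add: "tuple_char p n \<xi> (x \<oplus>\<^bsub>prime_field_power p n\<^esub> y) = tuple_char p n \<xi> x * tuple_char p n \<xi> y"
    for \<xi> x y
    by (simp add: add_prime_field_power[OF p] tuple_char_add[OF p0])
  show ?thesis
  proof (intro VectorSpace.subspace.intro submodule.intro)
    show "vectorspace (prime_field p) (prime_field_power p n)" "module (prime_field p) (prime_field_power p n)"
      by unfold_locales
    fix c v
    assume c: "c \<in> carrier (prime_field p)"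
      and v: "v \<in> {x \<in> carrier (prime_field_power p n). \<forall>\<xi>\<in>\<Gamma>. tuple_char p n \<xi> x = 1}"
    then have "0 \<le> c" by (simp add: residue_ring_def)
    with v have "\<forall>\<xi>\<in>\<Gamma>. tuple_char p n \<xi> (c \<odot>\<^bsub>prime_field_power p n\<^esub> v) = 1"
      by (simp add: smult_prime_field_power[OF p] tuple_char_smult[OF p0])
    then show "c \<odot>\<^bsub>prime_field_power p n\<^esub> v \<in> {x \<in> carrier (prime_field_power p n). \<forall>\<xi>\<in>\<Gamma>. tuple_char p n \<xi> x = 1}"
      using c v by simp
  next
    show "\<zero>\<^bsub>prime_field_power p n\<^esub> \<in> {x \<in> carrier (prime_field_power p n). \<forall>\<xi>\<in>\<Gamma>. tuple_char p n \<xi> x = 1}"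
      using zero by simp
  qed (simp_all add: add)
qed

section \<open>Stable sets are close to unions of cosets\<close>

theorem corollary1:
  fixes k :: nat
  assumes "k \<ge> 2"
  shows "\<exists>h :: real poly. \<forall>\<epsilon> :: real. \<forall>p :: nat. 0 < \<epsilon> \<and> \<epsilon> < 1 \<and> prime p \<longrightarrow>
    (\<exists>n\<^sub>1 :: nat. \<forall>n \<ge> n\<^sub>1. \<forall>G A.
      G = prime_field_power p n \<and> A \<subseteq> carrier G \<and> k_stable G k A \<longrightarrow>
        (\<exists>H I. VectorSpace.subspace (prime_field p) H G \<and>
               real (codim (prime_field p) G H) \<le> poly h (1 / \<epsilon>) \<and>
               I \<subseteq> a_rcosets\<^bsub>G\<^esub> H \<and>
               real (card (sym_diff A (\<Union>I))) \<le> \<epsilon> * real (card (carrier G))))"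
proof (intro exI[of _ "monom (4 * (32 * real k + 16) ^ (2 * k)) (2 * k)"] allI impI)
  fix \<epsilon> :: real and p :: nat
  assume "0 < \<epsilon> \<and> \<epsilon> < 1 \<and> prime p"
  then have \<epsilon>: "0 < \<epsilon>" "\<epsilon> < 1" and p: "prime p" by auto
  have k: "0 < k" using assms by simp
  show "\<exists>n\<^sub>1 :: nat. \<forall>n \<ge> n\<^sub>1. \<forall>G A.
      G = prime_field_power p n \<and> A \<subseteq> carrier G \<and> k_stable G k A \<longrightarrow>
        (\<exists>H I. VectorSpace.subspace (prime_field p) H G \<and>
               real (codim (prime_field p) G H) \<le> poly (monom (4 * (32 * real k + 16) ^ (2 * k)) (2 * k)) (1 / \<epsilon>) \<and>
               I \<subseteq> a_rcosets\<^bsub>G\<^esub> H \<and>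
               real (card (sym_diff A (\<Union>I))) \<le> \<epsilon> * real (card (carrier G)))"
  proof (intro exI[of _ 0] allI impI, elim conjE)
    fix n G A
    assume G: "G = prime_field_power p n" and A: "A \<subseteq> carrier G" and stable: "k_stable G k A"
    interpret V: vectorspace "prime_field p" G
      unfolding G using p by (rule vectorspace_prime_field_power)
    interpret orthogonal_characters G "carrier G" "tuple_char p n"
      unfolding G using p by (rule orthogonal_characters_tuple_char)
    let ?N = "real (card (carrier G))"
    \<comment> \<open>The spectral step costs a factor \<open>4\<close> and the rounding to cosets a factor \<open>2\<close>.\<close>
    define \<delta> where "\<delta> = \<epsilon> / 8"
    define M where "M = ((4 * real k + 2) / \<delta>) ^ (2 * k)"
    define S where "S = {h \<in> carrier G. translate_dist A \<zero>\<^bsub>G\<^esub> h \<le> \<delta> * ?N}"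
    have many: "?N \<le> M * card S"
      unfolding M_def S_def using stable k \<epsilon> by (intro many_almost_periods) (auto simp: \<delta>_def)
    have "S \<noteq> {}"
    proof
      assume "S = {}"
      with many card_carrier_pos show False by simp
    qed
    then have S_pos: "0 < real (card S)"
      by (simp add: S_def card_gt_0_iff)
    have "\<exists>\<Gamma>\<subseteq>carrier G. card \<Gamma> * card S \<le> 4 * card (carrier G) \<and>
        (\<forall>h\<in>carrier G. (\<forall>\<xi>\<in>\<Gamma>. tuple_char p n \<xi> h = 1) \<longrightarrow>
          translate_dist A \<zero>\<^bsub>G\<^esub> h \<le> 4 * \<delta> * ?N)"
      by (rule few_characters_control_periods[OF _ \<open>S \<noteq> {}\<close>]) (simp_all add: S_def)
    then obtain \<Gamma> where \<Gamma>: "\<Gamma> \<subseteq> carrier G" "card \<Gamma> * card S \<le> 4 * card (carrier G)"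
      and control: "\<forall>h\<in>carrier G. (\<forall>\<xi>\<in>\<Gamma>. tuple_char p n \<xi> h = 1) \<longrightarrow>
          translate_dist A \<zero>\<^bsub>G\<^esub> h \<le> 4 * \<delta> * ?N"
      by (elim exE conjE)
    define H where "H = {x \<in> carrier G. \<forall>\<xi>\<in>\<Gamma>. tuple_char p n \<xi> x = 1}"
    have H: "VectorSpace.subspace (prime_field p) H G"
      unfolding H_def G using p by (rule annihilator_subspace)
    have "codim (prime_field p) G H \<le> card \<Gamma>"
    proof (rule V.codim_le_of_card_le[OF _ finite_carrier H])
      have p0: "0 < p" using p by (rule prime_gt_0_nat)
      have "card (carrier G) \<le> card H * card {z :: complex. z ^ p = 1} ^ card \<Gamma>"
        unfolding H_def using p0 \<Gamma>(1)
        by (intro card_le_card_annihilator finite_roots_unity) (auto simp: tuple_char_power)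
      then show "card (carrier G) \<le> card H * card (carrier (prime_field p)) ^ card \<Gamma>"
        using card_roots_unity_eq[OF p0] by (simp add: residue_ring_def)
    qed (simp add: residue_ring_def)
    moreover have "card \<Gamma> \<le> 4 * M"
    proof -
      have "real (card \<Gamma>) * card S \<le> 4 * ?N"
        using of_nat_mono[OF \<Gamma>(2), where 'a = real] by simp
      also have "\<dots> \<le> (4 * M) * card S" using many by simp
      finally show ?thesis using S_pos by simp
    qed
    \<comment> \<open>Here \<open>\<delta> = \<epsilon> / 8\<close> turns \<open>(4 k + 2) / \<delta>\<close> into \<open>(32 k + 16) / \<epsilon>\<close>, which dictates the polynomial.\<close>
    moreover have "4 * M = poly (monom (4 * (32 * real k + 16) ^ (2 * k)) (2 * k)) (1 / \<epsilon>)"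
      by (simp add: M_def \<delta>_def poly_monom power_divide ring_distribs)
    ultimately have codim: "real (codim (prime_field p) G H) \<le>
        poly (monom (4 * (32 * real k + 16) ^ (2 * k)) (2 * k)) (1 / \<epsilon>)" by linarith
    have "additive_subgroup H G"
      unfolding H_def using \<Gamma>(1) by (rule annihilator_additive_subgroup)
    then have "\<exists>I \<subseteq> a_rcosets\<^bsub>G\<^esub> H. card (sym_diff A (\<Union>I)) \<le> 2 * (4 * \<delta> * ?N)"
      using A by (rule round_to_cosets) (use control in \<open>simp add: H_def\<close>)
    then obtain I where I: "I \<subseteq> a_rcosets\<^bsub>G\<^esub> H" "card (sym_diff A (\<Union>I)) \<le> 2 * (4 * \<delta> * ?N)"
      by (elim exE conjE)
    show "\<exists>H I. VectorSpace.subspace (prime_field p) H G \<and>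
       real (codim (prime_field p) G H) \<le> poly (monom (4 * (32 * real k + 16) ^ (2 * k)) (2 * k)) (1 / \<epsilon>) \<and>
       I \<subseteq> a_rcosets\<^bsub>G\<^esub> H \<and> real (card (sym_diff A (\<Union>I))) \<le> \<epsilon> * ?N"
    proof (intro exI conjI)
      show "real (card (sym_diff A (\<Union>I))) \<le> \<epsilon> * ?N" using I(2) by (simp add: \<delta>_def)
    qed (use H codim I(1) in auto)
  qed
qed

end
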